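(* Let $w\geq 2$ be an even integer, let $R(X)\in\mathbb{C}[X]$ be any polynomial of degree at most $w$, and let $Z(s)$ be the unique polynomial satisfying \[\frac{R(X)}{(1-X)^{w+1}}=\sum_{n\geq 0}Z(-n)X^n .\] Suppose that $R(X)$ satisfies both \[R(X)+(-iX)^wR(1/X)=0\] and \[R(X)+(-iX)^wR\left(\frac{X-i}{-iX}\right)+(-iX-1)^wR\left(\frac{-i}{-iX-1}\right)=0 .\] Then \[Z(s)+i^wZ(1-s)=0,\] and for any positive integer $n$ we have \begin{align*} Z(-n)&+(-i)^w\sum_{m=1}^{n+1}a_{-m}Z(1-m)\\ &+\sum_{k\geq 0}\sum_{m=0}^{k+n}\sum_{j=0}^{k+n-m}\binom{k+n}{n}\binom{m+w}{w}\binom{w+1}{j}\frac{(-1)^{j+1}(-i)^k}{(1-i)^{m+w+1}}\,Z(m+j-k-n)=0, \end{align*} where the complex numbers $a_m$ (depending on $n$ and $w$) are the coefficients of the Laurent expansion about $x=0$ \[\frac{(1-x)^{w+1}(x+i)^{n}}{(x+i-ix)^{w+1}(ix)^{n+1}}=\sum_{m=-n-1}^\infty a_mx^m .\]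
   Context: Here $i=\sqrt{-1}$. The identity defining $Z(s)\in\mathbb{C}[s]$ is an identity of power series in $X$ about $X=0$. The identity $Z(s)+i^wZ(1-s)=0$ is an identity of polynomials in $s$. The sum over $k\geq 0$ is an infinite series of complex numbers, whose $k$-th term is the finite double sum over $m$ and $j$. Binomial coefficients $\binom{w+1}{j}$ with $j>w+1$ are $0$. *)

theory Defs
  imports Complex_Main "HOL-Computational_Algebra.Computational_Algebra"
begin

definition laurent_a :: "nat \<Rightarrow> nat \<Rightarrow> int \<Rightarrow> complex" where
  "laurent_a w n m = fls_nth
     ((1 - fls_X) ^ (w + 1) * (fls_X + fls_const \<i>) ^ n /
      ((fls_X + fls_const \<i> - fls_const \<i> * fls_X) ^ (w + 1) *
       (fls_const \<i> * fls_X) ^ (n + 1))) m"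

end

theory Submission imports Defs "HOL-Complex_Analysis.Laurent_Convergence" begin

text \<open>
  The first relation says that \<open>r\<^sub>j = - (- \<i>)\<^sup>w r\<^sub>w\<^sub>-\<^sub>j\<close> for the coefficients of \<open>R\<close>; since
  \<open>Z(s) = (\<Sum>j. r\<^sub>j binom(w - j - s, w))\<close>, the symmetry of binomial polynomials yields the functional
  equation. Applying the first relation to the two transformed arguments in the second one turns
  it into the polynomial identity
  \<open>R(X) - (- \<i>)\<^sup>w S(X) - R(X - \<i>) = 0\<close> with \<open>S(X) = (X - \<i>)\<^sup>w R(- \<i>X / (X - \<i>))\<close>.
  Divide by \<open>(1 - X)\<^sup>w\<^sup>+\<^sup>1\<close> and compare coefficients of \<open>X\<^sup>n\<close>. The first summand contributes \<open>Z(-n)\<close>.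
  For the second one, the coefficient is a residue, and the substitution \<open>X = \<i>x / (x + \<i>)\<close> produces
  the Laurent coefficients \<open>a\<^sub>-\<^sub>m\<close>. For the third one, \<open>R(X - \<i>) / (1 - X)\<^sup>w\<^sup>+\<^sup>1\<close> is the Taylor
  expansion of \<open>g(x) = R(x) / (1 - \<i> - x)\<^sup>w\<^sup>+\<^sup>1\<close> at \<open>- \<i>\<close>, which lies inside the disc of
  convergence (of radius \<open>sqrt 2\<close>) of the expansion of \<open>g\<close> at \<open>0\<close>; re-expanding gives the sum over \<open>k\<close>.
\<close>

subsection \<open>The functional equation\<close>

lemma poly_eqI_cofinite:
  fixes p q :: "'a :: {idom, ring_char_0} poly"
  assumes "finite A" "\<And>x. x \<notin> A \<Longrightarrow> poly p x = poly q x"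
  shows "p = q"
proof (rule ccontr)
  assume "p \<noteq> q"
  hence "finite {x. poly (p - q) x = 0}"
    by (intro poly_roots_finite) simp
  moreover have "- A \<subseteq> {x. poly (p - q) x = 0}"
    using assms(2) by auto
  ultimately have "finite (- A \<union> A)"
    using assms(1) finite_subset by blast
  thus False by (simp add: infinite_UNIV_char_0)
qed

lemma poly_altdef_le:
  fixes p :: "'a :: comm_semiring_1 poly"
  assumes "degree p \<le> w"
  shows "poly p x = (\<Sum>j\<le>w. coeff p j * x ^ j)"
  unfolding poly_altdef
  by (rule sum.mono_neutral_left) (use assms in \<open>auto simp: coeff_eq_0\<close>)

text \<open>Multiplying \<open>poly R (1 / X)\<close> by \<open>X ^ w\<close> clears denominators
  and yields the polynomial \<open>Q\<close> with reversed coefficients. Agreement away from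
  \<open>X = 0\<close> then suffices for comparing coefficients.\<close>

lemma coeff_reciprocal:
  fixes R :: "complex poly"
  assumes deg: "degree R \<le> w"
    and inv: "\<And>X. X \<noteq> 0 \<Longrightarrow> poly R X + (c * X) ^ w * poly R (1 / X) = 0"
    and j: "j \<le> w"
  shows "coeff R j = - (c ^ w) * coeff R (w - j)"
proof -
  define Q where "Q = (\<Sum>j\<le>w. monom (coeff R (w - j)) j)"
  have "R = - smult (c ^ w) Q"
  proof (rule poly_eqI_cofinite[of "{0}"])
    fix X :: complex assume "X \<notin> {0}"
    hence X: "X \<noteq> 0" by simp
    have "X ^ w * poly R (1 / X) = (\<Sum>j\<le>w. coeff R j * X ^ (w - j))"
      unfolding poly_altdef_le[OF deg] sum_distrib_left
      by (intro sum.cong) (use X in \<open>auto simp: power_diff field_simps\<close>)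
    also have "\<dots> = (\<Sum>j\<le>w. coeff R (w - j) * X ^ j)"
      by (rule sum.reindex_bij_witness[of _ "\<lambda>j. w - j" "\<lambda>j. w - j"]) auto
    also have "\<dots> = poly Q X"
      by (simp add: Q_def poly_sum poly_monom)
    finally have "poly Q X = X ^ w * poly R (1 / X)" ..
    thus "poly R X = poly (- smult (c ^ w) Q) X"
      using inv[OF X] by (simp add: power_mult_distrib eq_neg_iff_add_eq_0 mult.assoc)
  qed simp
  hence "coeff R j = coeff (- smult (c ^ w) Q) j" by simp
  thus ?thesis using j by (simp add: Q_def coeff_sum coeff_monom)
qed

text \<open>With the lower index fixed at \<open>w\<close>, the binomial coefficient is a polynomial
  in \<open>k\<close>, which is the form needed to interpolate \<open>Z\<close>.\<close>

lemma inverse_one_minus_fps_X_power: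
  "inverse ((1 - fps_X) ^ Suc w :: 'a :: field_char_0 fps) = Abs_fps (\<lambda>k. of_nat ((k + w) choose w))"
proof (rule fps_ext)
  fix k
  show "fps_nth (inverse ((1 - fps_X) ^ Suc w :: 'a fps)) k =
     fps_nth (Abs_fps (\<lambda>k. of_nat ((k + w) choose w))) k"
    using one_minus_const_fps_X_neg_power'[of "Suc w" "1 :: 'a"] binomial_symmetric[of k "w + k"]
    by (simp add: add.commute)
qed

text \<open>Both sides are polynomials in \<open>s\<close> that agree at the infinitely many points
  \<open>s = -n\<close>, by comparing coefficients in the generating function.\<close>

lemma gen_fun_poly_eq_sum_gbinomial:
  fixes R Z :: "'a :: field_char_0 poly"
  assumes deg: "degree R \<le> w"
    and Z: "fps_of_poly R * inverse ((1 - fps_X) ^ Suc w) = Abs_fps (\<lambda>n. poly Z (- of_nat n))"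
  shows "poly Z s = (\<Sum>j\<le>w. coeff R j * ((of_nat (w - j) - s) gchoose w))"
proof -
  define B :: "nat \<Rightarrow> 'a poly" where
    "B j = smult (1 / fact w) (\<Prod>i = 0..<w. [:of_nat (w - j) - of_nat i, -1:])" for j
  have B: "poly (B j) s = (of_nat (w - j) - s) gchoose w" for j s
    by (simp add: B_def poly_prod gbinomial_prod_rev algebra_simps)
  define Q where "Q = (\<Sum>j\<le>w. smult (coeff R j) (B j))"
  have Q: "poly Q s = (\<Sum>j\<le>w. coeff R j * ((of_nat (w - j) - s) gchoose w))" for s
    by (simp add: Q_def poly_sum B)
  have "poly Z (- of_nat n) = poly Q (- of_nat n)" for n
  proof -
    have "poly Z (- of_nat n) = (\<Sum>j = 0..n. coeff R j * of_nat ((n - j + w) choose w))"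
      using arg_cong[OF Z, of "\<lambda>f. fps_nth f n"]
      unfolding inverse_one_minus_fps_X_power fps_mult_nth by simp
    \<comment> \<open>The ranges can be exchanged: for \<open>j > w\<close> the coefficient of
      \<open>R\<close> is 0, and for \<open>n < j \<le> w\<close> the upper index is below
      \<open>w\<close>, so the binomial is 0.\<close>
    also have "\<dots> = (\<Sum>j\<le>w. coeff R j * of_nat ((n + (w - j)) choose w))"
      by (rule sum.mono_neutral_cong)
         (use deg in \<open>auto simp: coeff_eq_0 not_le\<close>)
    also have "\<dots> = poly Q (- of_nat n)"
      unfolding Q by (intro sum.cong refl) (simp add: binomial_gbinomial of_nat_diff algebra_simps)
    finally show ?thesis .
  qed
  hence "(\<lambda>n. - of_nat n) ` UNIV \<subseteq> {x. poly (Z - Q) x = 0}"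
    by auto
  moreover have "infinite (range (\<lambda>n :: nat. - of_nat n :: 'a))"
    by (intro range_inj_infinite injI) simp
  ultimately have "Z - Q = 0"
    using poly_roots_finite[of "Z - Q"] finite_subset by blast
  thus ?thesis using Q by simp
qed

text \<open>Negating the upper index of a binomial of order \<open>w\<close> replaces
  \<open>w - j - (1 - s)\<close> by \<open>j - s\<close> at the cost of \<open>(-1) ^ w\<close>.
  Reversing the summation and using the symmetry of the coefficients then recovers
  \<open>Z(s)\<close> up to sign.\<close>

lemma gen_fun_poly_functional_equation:
  fixes R Z :: "'a :: field_char_0 poly"
  assumes deg: "degree R \<le> w"
    and Z: "fps_of_poly R * inverse ((1 - fps_X) ^ Suc w) = Abs_fps (\<lambda>n. poly Z (- of_nat n))"
    and sym: "\<And>j. j \<le> w \<Longrightarrow> coeff R j = - c * coeff R (w - j)"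
  shows "Z + smult ((-1) ^ w * c) (pcompose Z [:1, -1:]) = 0"
proof (rule poly_eqI_cofinite[of "{}"])
  fix s :: 'a
  have "poly Z (1 - s) = (\<Sum>j\<le>w. coeff R j * ((of_nat (w - j) - (1 - s)) gchoose w))"
    by (rule gen_fun_poly_eq_sum_gbinomial[OF deg Z])
  also have "\<dots> = (\<Sum>j\<le>w. coeff R j * ((-1) ^ w * ((of_nat j - s) gchoose w)))"
  proof (intro sum.cong refl arg_cong2[where f="(*)"])
    fix j assume "j \<in> {..w}"
    thus "((of_nat (w - j) - (1 - s)) gchoose w) = (-1) ^ w * ((of_nat j - s) gchoose w)"
      using gbinomial_negated_upper[of "of_nat (w - j) - (1 - s)" w]
      by (simp add: of_nat_diff algebra_simps)
  qed
  also have "\<dots> = (\<Sum>j\<le>w. coeff R (w - j) * ((-1) ^ w * ((of_nat (w - j) - s) gchoose w)))"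
    by (rule sum.reindex_bij_witness[of _ "\<lambda>j. w - j" "\<lambda>j. w - j"]) auto
  finally have "(-1) ^ w * c * poly Z (1 - s) =
      (\<Sum>j\<le>w. ((-1) ^ w * (-1) ^ w) * (c * coeff R (w - j) * ((of_nat (w - j) - s) gchoose w)))"
    by (simp add: sum_distrib_left mult_ac)
  also have "\<dots> = - (\<Sum>j\<le>w. coeff R j * ((of_nat (w - j) - s) gchoose w))"
    unfolding sum_negf[symmetric]
  proof (intro sum.cong refl)
    fix j assume "j \<in> {..w}"
    hence "c * coeff R (w - j) = - coeff R j"
      using sym[of j] by simp
    thus "(-1) ^ w * (-1) ^ w * (c * coeff R (w - j) * ((of_nat (w - j) - s) gchoose w)) =
        - (coeff R j * ((of_nat (w - j) - s) gchoose w))"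
      by (simp add: power_mult_distrib[symmetric])
  qed
  also have "\<dots> = - poly Z s"
    by (simp add: gen_fun_poly_eq_sum_gbinomial[OF deg Z])
  finally show "poly (Z + smult ((-1) ^ w * c) (pcompose Z [:1, -1:])) s = poly 0 s"
    by (simp add: poly_pcompose)
qed simp

subsection \<open>Residues under substitution\<close>

text \<open>Up to the nonzero factor \<open>k + 1\<close>, the series is the derivative of
  \<open>v powi (k + 1)\<close>, and derivatives have residue 0.\<close>

lemma fls_residue_power_int_times_deriv:
  fixes v :: "'a :: field_char_0 fls"
  assumes "k \<noteq> -1" "v \<noteq> 0"
  shows "fls_residue (v powi k * fls_deriv v) = 0"
proof -
  have D: "fls_deriv (v powi m) = of_int m * (v powi (m - 1) * fls_deriv v)" for m :: int
  proof (cases "m \<ge> 0")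
    case True
    then obtain j where j: "m = int j" by (metis nonneg_int_cases)
    show ?thesis
    proof (cases j)
      case (Suc i)
      have "m - 1 = int i" "v powi m = v ^ Suc i"
        by (simp_all only: j Suc power_int_of_nat)
      thus ?thesis by (simp add: j Suc fls_deriv_power mult.assoc del: power_Suc)
    qed (simp add: j)
  next
    case False
    then obtain j where j: "m = - int j" by (metis nle_le nonpos_int_cases)
    \<comment> \<open>The extra factor \<open>v\<close> avoids the exponent \<open>j - 1\<close>,
      which is truncated at \<open>j = 0\<close>.\<close>
    have P: "fls_deriv (v ^ j) * v = of_nat j * (v ^ j * fls_deriv v)"
    proof (cases "j = 0")
      case False
      have "fls_deriv (v ^ j) * v = of_nat j * ((v ^ (j - 1) * v) * fls_deriv v)"
        by (simp add: fls_deriv_power mult_ac)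
      also have "v ^ (j - 1) * v = v ^ j"
        using False by (intro power_minus_mult) simp
      finally show ?thesis .
    qed simp
    \<comment> \<open>The product being differentiated is 1; the product rule gives the derivative
      of the inverse.\<close>
    have "fls_deriv (inverse (v ^ j) * v ^ j) = 0"
      using assms by simp
    hence "fls_deriv (inverse (v ^ j)) * v ^ j = - (inverse (v ^ j) * fls_deriv (v ^ j))"
      unfolding fls_deriv_mult by (simp add: algebra_simps eq_neg_iff_add_eq_0)
    hence "fls_deriv (inverse (v ^ j)) = - (inverse (v ^ j) * inverse (v ^ j) * fls_deriv (v ^ j))"
      using assms by (simp add: field_simps)
    also have "fls_deriv (v ^ j) = of_nat j * (v ^ j * fls_deriv v) * inverse v"
      unfolding P[symmetric] using assms by simp
    finally show ?thesis
      using assms by (simp add: j power_int_minus power_int_diff field_simps)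
  qed
  define f where "f = v powi (k + 1)"
  have "fls_residue (fls_deriv f) = 0"
    by (rule fls_residue_deriv)
  hence "of_int (k + 1) * fls_residue (v powi k * fls_deriv v) = 0"
    unfolding f_def D[of "k + 1"] fls_residue_of_int_times by simp
  thus ?thesis using assms
    by (metis add.commute add_eq_0_iff2 mult_eq_0_iff of_int_eq_0_iff)
qed

lemma fps_to_fls_sum: "fps_to_fls (sum f A) = (\<Sum>x\<in>A. fps_to_fls (f x))"
  by (induction A rule: infinite_finite_induct) auto

text \<open>Formal change of variables \<open>X = V(x)\<close> in the residue of
  \<open>H / X ^ (n + 1)\<close>. Split \<open>H\<close> at degree \<open>n\<close>: the tail leaves
  a power series, which has no residue, and each lower term gives a power of \<open>V\<close> times
  its derivative, whose residue vanishes unless the exponent is -1.\<close>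

lemma fps_nth_conv_residue_compose:
  fixes H V :: "'a :: field_char_0 fps"
  assumes V0: "fps_nth V 0 = 0" and V1: "fps_nth V 1 \<noteq> 0"
  shows "fps_nth H n =
    fls_residue (fps_to_fls (H oo V) * fls_deriv (fps_to_fls V) / fps_to_fls V ^ (n + 1))"
proof -
  define v where "v = fps_to_fls V"
  define A where "A = fps_to_fls (fps_shift (Suc n) H oo V)"
  have [simp]: "V \<noteq> 0" using V1 by auto
  hence [simp]: "v \<noteq> 0" by (simp add: v_def)
  have sV: "subdegree V = 1"
    using V0 V1 by (intro subdegreeI) auto
  have "H = fps_shift (Suc n) H * fps_X ^ Suc n + fps_cutoff (Suc n) H"
    by (rule fps_shift_cutoff[symmetric])
  also have "fps_cutoff (Suc n) H = (\<Sum>k\<le>n. fps_const (fps_nth H k) * fps_X ^ k)"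
    by (rule fps_ext) (auto simp: fps_sum_nth fps_X_power_nth if_distrib cong: if_cong)
  finally have H: "H = fps_shift (Suc n) H * fps_X ^ Suc n + \<dots>" .
  have "H oo V = (fps_shift (Suc n) H oo V) * V ^ Suc n +
      (\<Sum>k\<le>n. fps_const (fps_nth H k) * V ^ k)"
    by (subst H) (simp add: fps_compose_add_distrib fps_compose_mult_distrib V0
        fps_compose_sum_distrib fps_compose_power[symmetric] del: power_Suc)
  hence "fps_to_fls (H oo V) = A * v ^ Suc n + (\<Sum>k\<le>n. fls_const (fps_nth H k) * v ^ k)"
    unfolding A_def v_def
    by (simp add: fls_times_fps_to_fls fps_to_fls_power fps_to_fls_sum del: power_Suc)
  hence "fps_to_fls (H oo V) * fls_deriv v / v ^ (n + 1) =
     A * fls_deriv v + (\<Sum>k\<le>n. fls_const (fps_nth H k) * (v ^ k / v ^ Suc n * fls_deriv v))"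
    by (simp add: add_divide_distrib distrib_right sum_distrib_right sum_divide_distrib
        mult.assoc del: power_Suc)
  also have "\<dots> = A * fls_deriv v +
      (\<Sum>k\<le>n. fls_const (fps_nth H k) * (v powi (int k - int n - 1) * fls_deriv v))"
    by (intro arg_cong2[where f="(+)"] sum.cong refl)
       (simp add: power_int_diff power_int_add field_simps)
  finally have "fls_residue (fps_to_fls (H oo V) * fls_deriv v / v ^ (n + 1)) =
      fls_residue (A * fls_deriv v) +
      (\<Sum>k\<le>n. fps_nth H k * fls_residue (v powi (int k - int n - 1) * fls_deriv v))"
    by (simp add: fls_nth_sum)
  also have "fls_residue (A * fls_deriv v) = 0"
    unfolding A_def v_def fls_deriv_fps_to_fls fls_times_fps_to_fls[symmetric] by simp
  also have "(\<Sum>k\<le>n. fps_nth H k * fls_residue (v powi (int k - int n - 1) * fls_deriv v)) =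
      (\<Sum>k\<le>n. if k = n then fps_nth H k else 0)"
  proof (intro sum.cong refl)
    fix k assume "k \<in> {..n}"
    show "fps_nth H k * fls_residue (v powi (int k - int n - 1) * fls_deriv v) =
        (if k = n then fps_nth H k else 0)"
    proof (cases "k = n")
      case True
      \<comment> \<open>The residue of the logarithmic derivative is the subdegree, here 1.\<close>
      have "fls_residue (inverse v * fls_deriv v) = 1"
        using fls_residue_deriv_times_inverse_eq_subdegree(2)[of v] sV
        by (simp add: v_def fls_subdegree_fls_to_fps)
      thus ?thesis using True by simp
    next
      case False
      thus ?thesis
        using fls_residue_power_int_times_deriv[of "int k - int n - 1" v] by simp
    qed
  qed
  finally show ?thesis by (simp add: v_def)
qed

text \<open>The hypothesis bounds the pole order of \<open>L\<close> by \<open>n + 1\<close>, so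
  only the exponent pairs \<open>- m\<close> and \<open>m - 1\<close> with
  \<open>1 \<le> m \<le> n + 1\<close> contribute to the coefficient of exponent -1.\<close>

lemma fls_residue_times_fps:
  fixes L :: "'a :: field fls"
  assumes L: "L * fls_X ^ (n + 1) = fps_to_fls P"
  shows "fls_residue (L * fps_to_fls F) = (\<Sum>m = 1..n + 1. fls_nth L (- int m) * fps_nth F (m - 1))"
proof -
  have L': "L = fls_shift (int (n + 1)) (fps_to_fls P)"
    unfolding L[symmetric] fls_X_power_times_conv_shift(2) by simp
  have "fls_residue (L * fps_to_fls F) = fps_nth (P * F) n"
    by (simp add: L' fls_shifted_times_simps flip: fls_times_fps_to_fls)
  also have "\<dots> = (\<Sum>i=0..n. fps_nth P i * fps_nth F (n - i))"
    by (rule fps_mult_nth)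
  also have "\<dots> = (\<Sum>m = 1..n + 1. fls_nth L (- int m) * fps_nth F (m - 1))"
    by (rule sum.reindex_bij_witness[of _ "\<lambda>m. n + 1 - m" "\<lambda>i. n + 1 - i"])
       (auto simp: L' nat_diff_distrib)
  finally show ?thesis .
qed

lemma fps_to_fls_eq_divideI:
  fixes P :: "'a :: field fps"
  assumes "P * Q = N" "Q \<noteq> 0"
  shows "fps_to_fls P = fps_to_fls N / fps_to_fls Q"
  using assms by (auto simp: fls_times_fps_to_fls field_simps)

text \<open>
  Residue substitution with \<open>X = \<i>x / (x + \<i>)\<close>, the inverse of \<open>x = - \<i>X / (X - \<i>)\<close>;
  it turns \<open>S(X) = (X - \<i>)\<^sup>w R(x)\<close> into \<open>R(x) / (x + \<i>)\<^sup>w\<close>.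
\<close>

lemma fps_nth_eq_laurent_a_sum:
  fixes R :: "complex poly"
  assumes deg: "degree R \<le> w"
  defines "S \<equiv> (\<Sum>j\<le>w. smult (coeff R j) ([:-\<i>, 1:] ^ (w - j) * [:0, -\<i>:] ^ j))"
  shows "fps_nth (fps_of_poly S * inverse ((1 - fps_X) ^ (w + 1))) n =
     - (\<Sum>m = 1..n + 1. laurent_a w n (- int m) *
          fps_nth (fps_of_poly R * inverse ((1 - fps_X) ^ (w + 1))) (m - 1))"
proof -
  define D :: "complex fps" where "D = (1 - fps_X) ^ (w + 1)"
  have D0: "fps_nth D 0 \<noteq> 0" by (simp add: D_def fps_power_zeroth)
  define H where "H = fps_of_poly S * inverse D"
  define F where "F = fps_of_poly R * inverse D"
  define c where "c = fls_const \<i>"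
  have cc: "c * c = -1" by (simp add: c_def)
  define Ef :: "complex fps" where "Ef = fps_X + fps_const \<i>"
  define Kf :: "complex fps" where "Kf = fps_X + fps_const \<i> - fps_const \<i> * fps_X"
  define E where "E = fls_X + c"
  define K where "K = E - c * fls_X"
  have E_fps: "E = fps_to_fls Ef" and K_fps: "K = fps_to_fls Kf"
    by (simp_all add: E_def K_def Ef_def Kf_def c_def fls_times_fps_to_fls)
  have Ef0: "fps_nth Ef 0 \<noteq> 0" and Kf0: "fps_nth Kf 0 \<noteq> 0"
    by (simp_all add: Ef_def Kf_def)
  have E0: "E \<noteq> 0" and K0: "K \<noteq> 0"
    using Ef0 Kf0 by (auto simp: E_fps K_fps)
  have c0: "c \<noteq> 0" by (simp add: c_def)
  \<comment> \<open>\<open>V\<close> is \<open>X\<close> as a series in \<open>x\<close>. The facts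
    below express \<open>X - \<i>\<close>, \<open>- \<i> * X\<close> and \<open>1 - X\<close> as
    fractions with denominator \<open>E\<close>.\<close>
  define V where "V = fps_const \<i> * fps_X * inverse Ef"
  define v where "v = fps_to_fls V"
  have VE: "V * Ef = fps_const \<i> * fps_X"
    using Ef0 by (simp add: V_def mult.assoc inverse_mult_eq_1)
  have vE: "v * E = c * fls_X"
    using arg_cong[OF VE, of fps_to_fls] by (simp add: v_def E_fps c_def fls_times_fps_to_fls)
  have V0: "fps_nth V 0 = 0" by (simp add: V_def)
  have V1: "fps_nth V 1 \<noteq> 0"
    using Ef0 by (simp add: V_def mult.assoc)
  have v_eq: "v = c * fls_X / E"
    using vE E0 by (simp add: field_simps)
  have v_c: "v - c = 1 / E"
    using E0 vE cc by (simp add: field_simps E_def)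
  have cv: "- c * v = fls_X / E"
  proof -
    have "(- c * v) * E = - (c * c) * fls_X" using vE by (simp add: mult.assoc)
    thus ?thesis using E0 cc by (simp add: field_simps)
  qed
  have one_v: "1 - v = K / E"
    using E0 vE by (simp add: field_simps K_def)
  have one_v0: "1 - v \<noteq> 0" using one_v E0 K0 by simp

  have SX: "fps_of_poly [:-\<i>, 1:] oo V = V - fps_const \<i>"
    by (simp add: fps_of_poly_linear fps_compose_sub_distrib V0 fps_const_neg[symmetric]
        del: fps_const_neg)
  have SX': "fps_of_poly [:0, -\<i>:] oo V = - fps_const \<i> * V"
    by (simp add: fps_of_poly_pCons fps_compose_mult_distrib V0 mult.commute)
  have "fps_of_poly S oo V = (\<Sum>j\<le>w. fps_const (coeff R j) *
      ((V - fps_const \<i>) ^ (w - j) * (- fps_const \<i> * V) ^ j))"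
    by (simp add: S_def fps_of_poly_sum fps_of_poly_smult fps_of_poly_mult fps_of_poly_power
         fps_compose_sum_distrib fps_compose_mult_distrib[OF V0] fps_compose_power[OF V0, symmetric]
         SX SX')
  hence "fps_to_fls (fps_of_poly S oo V) = (\<Sum>j\<le>w. fls_const (coeff R j) *
      ((v - c) ^ (w - j) * (- c * v) ^ j))"
    by (simp add: fps_to_fls_sum fls_times_fps_to_fls fps_to_fls_power v_def c_def)
  \<comment> \<open>Each summand of \<open>S\<close> is homogeneous of degree \<open>w\<close> in
    the two linear factors, so \<open>E ^ w\<close> comes out as a common denominator.\<close>
  also have "\<dots> = (\<Sum>j\<le>w. fls_const (coeff R j) * fls_X ^ j / E ^ w)"
    unfolding v_c cv
    by (intro sum.cong refl) (use E0 in \<open>auto simp: power_divide power_diff field_simps\<close>)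
  also have "\<dots> = fps_to_fls (\<Sum>j\<le>w. fps_const (coeff R j) * fps_X ^ j) / E ^ w"
    by (simp add: sum_divide_distrib fps_to_fls_sum fls_times_fps_to_fls fps_to_fls_power)
  also have "(\<Sum>j\<le>w. fps_const (coeff R j) * fps_X ^ j) = fps_of_poly R"
    by (rule fps_ext) (use deg in \<open>auto simp: fps_sum_nth fps_X_power_nth if_distrib
        coeff_eq_0 cong: if_cong\<close>)
  finally have SV: "fps_to_fls (fps_of_poly S oo V) = fps_to_fls (fps_of_poly R) / E ^ w" .

  have DV: "fps_to_fls (D oo V) = (1 - v) ^ (w + 1)"
    by (simp add: D_def fps_compose_power[OF V0, symmetric] fps_compose_sub_distrib V0
        fps_to_fls_power v_def del: power_Suc)
  have "H * D = fps_of_poly S"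
    using D0 by (simp add: H_def mult.assoc inverse_mult_eq_1)
  hence "(H oo V) * (D oo V) = fps_of_poly S oo V"
    using fps_compose_mult_distrib[OF V0] by metis
  hence "fps_to_fls (H oo V) * (1 - v) ^ (w + 1) = fps_to_fls (fps_of_poly R) / E ^ w"
    using DV SV by (metis fls_times_fps_to_fls)
  hence HV: "fps_to_fls (H oo V) = fps_to_fls (fps_of_poly R) * E / K ^ (w + 1)"
    unfolding one_v using E0 K0 by (simp add: field_simps)

  \<comment> \<open>Differentiating \<open>v * E = c * fls_X\<close> avoids a quotient rule. The
    sign of the resulting \<open>-1 / E ^ 2\<close> is the minus sign in front of the final
    sum.\<close>
  have "fls_deriv (v * E) = c"
    unfolding vE by (simp add: c_def)
  hence "fls_deriv v * E + v = c"
    by (simp add: E_def c_def algebra_simps)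
  hence "fls_deriv v * E = - (v - c)"
    by (simp add: algebra_simps)
  hence dv: "fls_deriv v = - 1 / E ^ 2"
    unfolding v_c using E0 by (simp add: field_simps power2_eq_square)

  define L where "L = (1 - fls_X) ^ (w + 1) * E ^ n / (K ^ (w + 1) * (c * fls_X) ^ (n + 1))"
  have L: "laurent_a w n m = fls_nth L m" for m
    by (simp add: laurent_a_def L_def E_def K_def c_def)
  have D1: "fps_to_fls D = (1 - fls_X) ^ (w + 1)"
    by (simp add: D_def fps_to_fls_power del: power_Suc)
  have Ff: "fps_to_fls F = fps_to_fls (fps_of_poly R) / (1 - fls_X) ^ (w + 1)"
    unfolding D1[symmetric]
    by (rule fps_to_fls_eq_divideI) (use D0 in \<open>auto simp: F_def mult.assoc inverse_mult_eq_1\<close>)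
  have u1: "(1 - fls_X :: complex fls) \<noteq> 0"
    using D0 D1 by (metis fps_nonzero_nth fps_to_fls_nonzeroI power_0_left zero_neq_one add_is_0)
  \<comment> \<open>The powers of \<open>E\<close> combine to
    \<open>E ^ (1 - 2 + n + 1) = E ^ n\<close>; the factor \<open>d = (1 - x) ^ (w + 1)\<close> is
    inserted to turn \<open>R\<close> into \<open>F\<close>.\<close>
  have alg: "r * e / k * (- 1 / e ^ 2) / (x / e) ^ (n + 1) =
      - (d * e ^ n / (k * x ^ (n + 1)) * (r / d))"
    if "e \<noteq> 0" "k \<noteq> 0" "x \<noteq> 0" "d \<noteq> 0" for r e k x d :: "complex fls"
    using that by (simp add: power_divide power2_eq_square divide_simps)
  have "fps_nth H n = fls_residue (fps_to_fls (H oo V) * fls_deriv v / v ^ (n + 1))"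
    unfolding v_def by (rule fps_nth_conv_residue_compose[OF V0 V1])
  also have "fps_to_fls (H oo V) * fls_deriv v / v ^ (n + 1) = - (L * fps_to_fls F)"
    unfolding HV dv
    unfolding v_eq L_def Ff by (rule alg) (use E0 K0 c0 u1 in auto)
  also have "fls_residue \<dots> = - fls_residue (L * fps_to_fls F)"
    by simp
  also have "fls_residue (L * fps_to_fls F) =
      (\<Sum>m = 1..n + 1. fls_nth L (- int m) * fps_nth F (m - 1))"
  proof (rule fls_residue_times_fps)
    \<comment> \<open>\<open>Q\<close> is the denominator of \<open>L\<close> without its factor
      \<open>x ^ (n + 1)\<close>; it is a unit because \<open>Kf\<close> has constant term
      \<open>\<i>\<close>.\<close>
    define Q where "Q = Kf ^ (w + 1) * fps_const \<i> ^ (n + 1)"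
    have Q0: "fps_nth Q 0 \<noteq> 0"
      using Kf0 by (simp add: Q_def fps_power_zeroth)
    have "fps_to_fls (D * Ef ^ n * inverse Q) = fps_to_fls (D * Ef ^ n) / fps_to_fls Q"
      by (rule fps_to_fls_eq_divideI) (use Q0 in \<open>auto simp: mult.assoc inverse_mult_eq_1\<close>)
    also have "\<dots> = L * fls_X ^ (n + 1)"
      unfolding L_def Q_def fls_times_fps_to_fls fps_to_fls_power D1 E_fps[symmetric] K_fps[symmetric]
      using K0 c0 by (simp add: c_def power_mult_distrib divide_simps)
    finally show "L * fls_X ^ (n + 1) = fps_to_fls (D * Ef ^ n * inverse Q)" ..
  qed
  finally show ?thesis
    unfolding H_def F_def D_def L .
qed

subsection \<open>Re-expansion of power series\<close>

text \<open>This is the Taylor series at 0 of the \<open>n\<close>-th derivative of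
  \<open>f\<close>, evaluated at \<open>y\<close> and divided by \<open>n!\<close>; the quotient of
  factorials becomes the binomial coefficient.\<close>

lemma has_fps_expansion_shift_sums:
  fixes f :: "complex \<Rightarrow> complex"
  assumes F: "f has_fps_expansion F" and G: "(\<lambda>x. f (y + x)) has_fps_expansion G"
    and f: "f holomorphic_on ball 0 r" and y: "norm y < r"
  shows "(\<lambda>k. of_nat ((k + n) choose n) * fps_nth F (k + n) * y ^ k) sums fps_nth G n"
proof -
  define h where "h = (deriv ^^ n) f"
  have "h holomorphic_on ball 0 r"
    unfolding h_def by (intro holomorphic_higher_deriv f) auto
  hence "(\<lambda>k. (deriv ^^ k) h 0 / fact k * (y - 0) ^ k) sums h y"
    by (rule holomorphic_power_series) (use y in auto)
  hence "(\<lambda>k. (deriv ^^ k) h 0 / fact k * (y - 0) ^ k / fact n) sums (h y / fact n)"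
    by (rule sums_divide)
  also have "(\<lambda>k. (deriv ^^ k) h 0 / fact k * (y - 0) ^ k / fact n) =
      (\<lambda>k. of_nat ((k + n) choose n) * fps_nth F (k + n) * y ^ k)"
    by (simp add: h_def fps_nth_fps_expansion[OF F] funpow_add binomial_fact mult_ac)
  also have "h y / fact n = fps_nth G n"
    unfolding fps_nth_fps_expansion[OF G] h_def
    using higher_deriv_shift_0[of n f y] by (simp add: o_def)
  finally show ?thesis .
qed

lemma has_fps_expansion_poly: "poly p has_fps_expansion fps_of_poly (p :: complex poly)"
proof (induction p)
  case (pCons a p)
  have "(\<lambda>x. a + x * poly p x) has_fps_expansion (fps_const a + fps_X * fps_of_poly p)"
    by (intro fps_expansion_intros pCons.IH)
  thus ?case by (simp add: fps_of_poly_pCons mult.commute)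
qed simp

text \<open>The only possible singularity of \<open>R(x) / (a - x) ^ p\<close> is
  \<open>x = a\<close>, so the function is holomorphic on the disc of radius \<open>norm a\<close>
  around 0, which contains \<open>y\<close>.\<close>

lemma poly_div_linear_power_shift_sums:
  fixes R :: "complex poly"
  assumes y: "norm y < norm a"
  shows "(\<lambda>k. of_nat ((k + n) choose n) *
             fps_nth (fps_of_poly R * inverse ((fps_const a - fps_X) ^ p)) (k + n) * y ^ k)
         sums fps_nth (fps_of_poly (pcompose R [:y, 1:]) * inverse ((fps_const (a - y) - fps_X) ^ p)) n"
proof (rule has_fps_expansion_shift_sums)
  have a: "a \<noteq> 0" "a - y \<noteq> 0" using y by auto
  have nz: "a - x \<noteq> 0" if "norm x < norm a" for x using that by auto
  show "(\<lambda>x. poly R x * inverse ((a - x) ^ p)) has_fps_expansion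
      fps_of_poly R * inverse ((fps_const a - fps_X) ^ p)"
    using a by (intro fps_expansion_intros has_fps_expansion_poly) (auto simp: fps_power_zeroth)
  have "(\<lambda>x. poly (pcompose R [:y, 1:]) x * inverse ((a - y - x) ^ p)) has_fps_expansion
      fps_of_poly (pcompose R [:y, 1:]) * inverse ((fps_const (a - y) - fps_X) ^ p)"
    using a by (intro fps_expansion_intros has_fps_expansion_poly) (auto simp: fps_power_zeroth)
  thus "(\<lambda>x. poly R (y + x) * inverse ((a - (y + x)) ^ p)) has_fps_expansion
      fps_of_poly (pcompose R [:y, 1:]) * inverse ((fps_const (a - y) - fps_X) ^ p)"
    by (simp add: poly_pcompose algebra_simps)
  show "(\<lambda>x. poly R x * inverse ((a - x) ^ p)) holomorphic_on ball 0 (norm a)"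
    by (intro holomorphic_intros) (use nz in auto)
qed (use y in auto)

subsection \<open>The period relations\<close>

text \<open>Inverting the arguments \<open>q\<close> and \<open>p\<close> of the last two terms
  gives \<open>1 / q = - \<i> * X / (X - \<i>)\<close> and \<open>1 / p = X - \<i>\<close>. The
  first has its denominator cleared by \<open>(X - \<i>) ^ w\<close>; the second is already
  polynomial.\<close>

lemma three_term_polynomial_relation:
  fixes R :: "complex poly"
  assumes w: "even w" and deg: "degree R \<le> w"
    and inv: "\<And>X. X \<noteq> 0 \<Longrightarrow> poly R X + (- \<i> * X) ^ w * poly R (1 / X) = 0"
    and three: "\<And>X. - \<i> * X \<noteq> 0 \<Longrightarrow> - \<i> * X - 1 \<noteq> 0 \<Longrightarrow>
           poly R X + (- \<i> * X) ^ w * poly R ((X - \<i>) / (- \<i> * X))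
             + (- \<i> * X - 1) ^ w * poly R (- \<i> / (- \<i> * X - 1)) = 0"
  defines "S \<equiv> (\<Sum>j\<le>w. smult (coeff R j) ([:-\<i>, 1:] ^ (w - j) * [:0, -\<i>:] ^ j))"
  shows "R - smult ((- \<i>) ^ w) S - pcompose R [:-\<i>, 1:] = 0"
\<comment> \<open>The excluded points are the zeros of the denominators \<open>- \<i> * X\<close>
  and \<open>- \<i> * X - 1\<close>.\<close>
proof (rule poly_eqI_cofinite[of "{0, \<i>}"])
  fix X assume "X \<notin> {0, \<i>}"
  hence X: "X \<noteq> 0" "X - \<i> \<noteq> 0" by auto
  define q where "q = (X - \<i>) / (- \<i> * X)"
  define p where "p = - \<i> / (- \<i> * X - 1)"
  have d: "- \<i> * X - 1 = - \<i> * (X - \<i>)" by (simp add: algebra_simps)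
  have d0: "- \<i> * X \<noteq> 0" "- \<i> * X - 1 \<noteq> 0" unfolding d using X by auto
  have q0: "q \<noteq> 0" using X by (simp add: q_def)
  have p: "p = 1 / (X - \<i>)" unfolding p_def d using X by simp
  have p0: "p \<noteq> 0" using X by (simp add: p)
  have inv_q: "1 / q = (- \<i> * X) / (X - \<i>)" using X by (simp add: q_def)
  have "poly S X = (\<Sum>j\<le>w. coeff R j * ((X - \<i>) ^ (w - j) * (- \<i> * X) ^ j))"
    by (simp add: S_def poly_sum poly_mult poly_power algebra_simps)
  also have "\<dots> = (X - \<i>) ^ w * poly R (1 / q)"
    unfolding poly_altdef_le[OF deg] sum_distrib_left inv_q power_divide
    by (intro sum.cong refl) (use X in \<open>simp add: power_diff\<close>)
  finally have S: "poly S X = (X - \<i>) ^ w * poly R (1 / q)" .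
  have scaled: "a ^ w * poly R x = - ((a * (- \<i> * x)) ^ w * poly R (1 / x))" if "x \<noteq> 0" for a x
  proof -
    have "poly R x = - ((- \<i> * x) ^ w * poly R (1 / x))"
      using inv[OF that] by (simp add: eq_neg_iff_add_eq_0)
    thus ?thesis
      by (simp only: power_mult_distrib mult_minus_right mult.assoc)
  qed
  have "(- \<i> * X) ^ w * poly R q = - (((- \<i> * X) * (- \<i> * q)) ^ w * poly R (1 / q))"
    by (rule scaled[OF q0])
  also have "(- \<i> * X) * (- \<i> * q) = - \<i> * (X - \<i>)"
    using X by (simp add: q_def)
  finally have 1: "(- \<i> * X) ^ w * poly R q = - ((- \<i>) ^ w * poly S X)"
    by (simp only: S power_mult_distrib mult.assoc)
  have "(- \<i> * X - 1) ^ w * poly R p = - (((- \<i> * X - 1) * (- \<i> * p)) ^ w * poly R (1 / p))"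
    by (rule scaled[OF p0])
  also have "(- \<i> * X - 1) * (- \<i> * p) = - 1"
    using X unfolding d p by simp
  \<comment> \<open>The prefactor \<open>(-1) ^ w\<close> is 1 since \<open>w\<close> is
    even.\<close>
  finally have 2: "(- \<i> * X - 1) ^ w * poly R p = - poly R (X - \<i>)"
    using w by (simp add: p)
  show "poly (R - smult ((- \<i>) ^ w) S - pcompose R [:-\<i>, 1:]) X = poly 0 X"
    using three[OF d0, folded q_def p_def] unfolding 1 2
    by (simp add: poly_pcompose algebra_simps)
qed simp

section \<open>Explicit coefficients of powers of \<open>a - X\<close>\<close>

lemma inverse_const_minus_fps_X_power:
  fixes a :: "'a :: field_char_0"
  assumes "a \<noteq> 0"
  shows "inverse ((fps_const a - fps_X) ^ Suc w) =
    Abs_fps (\<lambda>m. of_nat ((m + w) choose w) / a ^ (m + Suc w))"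
proof -
  have "fps_const a - fps_X = fps_const a * (1 - fps_const (inverse a) * fps_X)"
    using assms by (simp add: algebra_simps flip: mult.assoc)
  hence "inverse ((fps_const a - fps_X) ^ Suc w) =
      fps_const (inverse a ^ Suc w) * inverse ((1 - fps_const (inverse a) * fps_X) ^ Suc w)"
    by (simp only: power_mult_distrib fps_inverse_mult fps_const_power fps_const_inverse power_inverse)
  also have "\<dots> = Abs_fps (\<lambda>m. of_nat ((m + w) choose w) / a ^ (m + Suc w))"
    unfolding one_minus_const_fps_X_neg_power'[OF zero_less_Suc]
  proof (rule fps_ext)
    fix m
    show "fps_nth (fps_const (inverse a ^ Suc w) *
        Abs_fps (\<lambda>k. of_nat ((Suc w + k - 1) choose k) * inverse a ^ k)) m =
      fps_nth (Abs_fps (\<lambda>m. of_nat ((m + w) choose w) / a ^ (m + Suc w))) m"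
      using binomial_symmetric[of m "w + m"]
      by (simp add: add.commute power_add field_simps)
  qed
  finally show ?thesis .
qed

lemma one_minus_fps_X_power_nth:
  "fps_nth ((1 - fps_X :: 'a :: field_char_0 fps) ^ p) j = (-1) ^ j * of_nat (p choose j)"
proof -
  have "(1 - fps_X :: 'a fps) ^ p = fps_compose (fps_binomial (of_nat p)) (- fps_const 1 * fps_X)"
    using one_minus_const_fps_X_power[of "1 :: 'a" p] by simp
  also have "- fps_const 1 * fps_X = (fps_const (-1) * fps_X :: 'a fps)"
    by (simp flip: fps_const_neg)
  finally show ?thesis
    by (simp only: fps_compose_linear fps_nth_Abs_fps fps_binomial_nth binomial_gbinomial)
qed

theorem theorem2:
  fixes w :: nat and R Z :: "complex poly"
  assumes "w \<ge> 2" and "even w"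
    and "degree R \<le> w"
    and "fps_of_poly R / (1 - fps_X) ^ (w + 1) = Abs_fps (\<lambda>n. poly Z (- of_nat n))"
    and "\<And>X :: complex. X \<noteq> 0 \<Longrightarrow>
           poly R X + (- \<i> * X) ^ w * poly R (1 / X) = 0"
    and "\<And>X :: complex. - \<i> * X \<noteq> 0 \<Longrightarrow> - \<i> * X - 1 \<noteq> 0 \<Longrightarrow>
           poly R X + (- \<i> * X) ^ w * poly R ((X - \<i>) / (- \<i> * X))
             + (- \<i> * X - 1) ^ w * poly R (- \<i> / (- \<i> * X - 1)) = 0"
  shows "Z + smult (\<i> ^ w) (pcompose Z [:1, -1:]) = 0 \<and>
    (\<forall>n :: nat. n > 0 \<longrightarrow>
      (let T = (\<lambda>k :: nat. \<Sum>m = 0..k + n. \<Sum>j = 0..k + n - m.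
                 of_nat ((k + n) choose n) * of_nat ((m + w) choose w) *
                 of_nat ((w + 1) choose j) *
                 ((- 1) ^ (j + 1) * (- \<i>) ^ k / (1 - \<i>) ^ (m + w + 1)) *
                 poly Z (of_nat m + of_nat j - of_nat k - of_nat n))
       in summable T \<and>
          poly Z (- of_nat n)
            + (- \<i>) ^ w * (\<Sum>m = 1..n + 1. laurent_a w n (- int m) * poly Z (1 - of_nat m))
            + (\<Sum>k. T k) = 0))"
proof (intro conjI allI impI)
  note w = assms(2) and deg = assms(3) and inv = assms(5) and three = assms(6)
  define D :: "complex fps" where "D = (1 - fps_X) ^ (w + 1)"
  define F where "F = fps_of_poly R * inverse D"
  have D0: "fps_nth D 0 \<noteq> 0" by (simp add: D_def fps_power_zeroth)
  have F: "F = Abs_fps (\<lambda>n. poly Z (- of_nat n))"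
    using assms(4) fps_divide_unit[OF D0] unfolding F_def D_def by simp
  have FD: "F * D = fps_of_poly R"
    using D0 by (simp add: F_def mult.assoc inverse_mult_eq_1)
  \<comment> \<open>Here \<open>c = (- \<i>) ^ w\<close>, and the product of the two powers is
    \<open>\<i> ^ w\<close>.\<close>
  have "Z + smult ((-1) ^ w * (- \<i>) ^ w) (pcompose Z [:1, -1:]) = 0"
  proof (rule gen_fun_poly_functional_equation[OF deg])
    show "fps_of_poly R * inverse ((1 - fps_X) ^ Suc w) = Abs_fps (\<lambda>n. poly Z (- of_nat n))"
      using F by (simp add: F_def D_def)
    show "coeff R j = - ((- \<i>) ^ w) * coeff R (w - j)" if "j \<le> w" for j
      by (rule coeff_reciprocal[OF deg inv that])
  qed
  thus "Z + smult (\<i> ^ w) (pcompose Z [:1, -1:]) = 0"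
    by (simp flip: power_mult_distrib)

  fix n :: nat
  define T where "T = (\<lambda>k :: nat. \<Sum>m = 0..k + n. \<Sum>j = 0..k + n - m.
                 of_nat ((k + n) choose n) * of_nat ((m + w) choose w) *
                 of_nat ((w + 1) choose j) *
                 ((- 1) ^ (j + 1) * (- \<i>) ^ k / (1 - \<i>) ^ (m + w + 1)) *
                 poly Z (of_nat m + of_nat j - of_nat k - of_nat n))"
  define G where "G = fps_of_poly R * inverse ((fps_const (1 - \<i>) - fps_X) ^ (w + 1))"
  have i1: "1 - \<i> \<noteq> 0" by (simp add: complex_eq_iff)
  \<comment> \<open>Since \<open>R = D * F\<close>, the series \<open>G\<close> is a product of
    three factors with known coefficients. Its double convolution is the sum over \<open>m\<close>
    and \<open>j\<close>, with the values of \<open>Z\<close> coming from \<open>F\<close>.\<close>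
  have T: "T k = - (of_nat ((k + n) choose n) * fps_nth G (k + n) * (- \<i>) ^ k)" for k
  proof -
    have "G = inverse ((fps_const (1 - \<i>) - fps_X) ^ Suc w) * (D * F)"
      unfolding G_def FD[symmetric] by (simp add: mult_ac)
    hence "fps_nth G (k + n) = (\<Sum>m = 0..k + n. \<Sum>j = 0..k + n - m.
        of_nat ((m + w) choose w) / (1 - \<i>) ^ (m + Suc w) *
        ((-1) ^ j * of_nat ((w + 1) choose j) * fps_nth F (k + n - m - j)))"
      unfolding inverse_const_minus_fps_X_power[OF i1] D_def
      by (simp only: fps_mult_nth one_minus_fps_X_power_nth fps_nth_Abs_fps sum_distrib_left)
    hence "- (of_nat ((k + n) choose n) * fps_nth G (k + n) * (- \<i>) ^ k) =
      (\<Sum>m = 0..k + n. \<Sum>j = 0..k + n - m. - (of_nat ((k + n) choose n) * (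
        of_nat ((m + w) choose w) / (1 - \<i>) ^ (m + Suc w) *
        ((-1) ^ j * of_nat ((w + 1) choose j) * fps_nth F (k + n - m - j))) * (- \<i>) ^ k))"
      by (simp only: sum_distrib_left sum_distrib_right sum_negf)
    also have "\<dots> = T k"
      unfolding T_def
    proof (intro sum.cong refl)
      fix m j assume "m \<in> {0..k + n}" "j \<in> {0..k + n - m}"
      \<comment> \<open>This makes the subtraction \<open>k + n - m - j\<close> exact, so the
        argument of \<open>Z\<close> is minus a natural number.\<close>
      hence le: "m + j \<le> k + n" by auto
      then obtain d where d: "k + n = m + j + d"
        using le_Suc_ex by blast
      have "(of_nat k + of_nat n :: complex) = of_nat m + of_nat j + of_nat d"
        using arg_cong[OF d, of "of_nat :: nat \<Rightarrow> complex"] by simp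
      hence "- of_nat (k + n - m - j) = (of_nat m + of_nat j - of_nat k - of_nat n :: complex)"
        unfolding d by (simp add: algebra_simps)
      hence "fps_nth F (k + n - m - j) = poly Z (of_nat m + of_nat j - of_nat k - of_nat n)"
        by (simp add: F)
      thus "- (of_nat ((k + n) choose n) * (of_nat ((m + w) choose w) / (1 - \<i>) ^ (m + Suc w) *
          ((-1) ^ j * of_nat ((w + 1) choose j) * fps_nth F (k + n - m - j))) * (- \<i>) ^ k) =
        of_nat ((k + n) choose n) * of_nat ((m + w) choose w) *
                 of_nat ((w + 1) choose j) *
                 ((- 1) ^ (j + 1) * (- \<i>) ^ k / (1 - \<i>) ^ (m + w + 1)) *
                 poly Z (of_nat m + of_nat j - of_nat k - of_nat n)"
        by (simp only: add_Suc_right Suc_eq_plus1[symmetric] power_Suc) (simp add: mult_ac)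
    qed
    finally show ?thesis ..
  qed
  hence T': "T = (\<lambda>k. - (of_nat ((k + n) choose n) * fps_nth G (k + n) * (- \<i>) ^ k))"
    by (rule ext)
  define S where "S = (\<Sum>j\<le>w. smult (coeff R j) ([:-\<i>, 1:] ^ (w - j) * [:0, -\<i>:] ^ j))"
  define A where "A = fps_nth (fps_of_poly S * inverse D) n"
  define B where "B = fps_nth (fps_of_poly (pcompose R [:-\<i>, 1:]) * inverse D) n"
  \<comment> \<open>The shift is \<open>y = - \<i>\<close> with \<open>a = 1 - \<i>\<close>: its
    norm 1 is less than \<open>sqrt 2\<close>, and \<open>a - y = 1\<close> turns the shifted
    denominator into \<open>D\<close>.\<close>
  have "(\<lambda>k. of_nat ((k + n) choose n) * fps_nth G (k + n) * (- \<i>) ^ k) sums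
      fps_nth (fps_of_poly (pcompose R [:- \<i>, 1:]) *
        inverse ((fps_const ((1 - \<i>) - (- \<i>)) - fps_X) ^ (w + 1))) n"
    unfolding G_def
    by (rule poly_div_linear_power_shift_sums) (simp add: cmod_def)
  from sums_minus[OF this] have sums: "T sums - B"
    by (simp add: T' B_def D_def)
  have "A = - (\<Sum>m = 1..n + 1. laurent_a w n (- int m) * fps_nth F (m - 1))"
    unfolding A_def S_def D_def F_def by (rule fps_nth_eq_laurent_a_sum[OF deg])
  also have "(\<Sum>m = 1..n + 1. laurent_a w n (- int m) * fps_nth F (m - 1)) =
      (\<Sum>m = 1..n + 1. laurent_a w n (- int m) * poly Z (1 - of_nat m))"
    by (intro sum.cong refl) (simp add: F of_nat_diff)
  finally have A: "(\<Sum>m = 1..n + 1. laurent_a w n (- int m) * poly Z (1 - of_nat m)) = - A"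
    by simp
  \<comment> \<open>Dividing this identity by \<open>D\<close> and taking the coefficient of
    \<open>X ^ n\<close> turns its three terms into the three parts of the claimed relation.\<close>
  have "R - smult ((- \<i>) ^ w) S - pcompose R [:-\<i>, 1:] = 0"
    unfolding S_def by (rule three_term_polynomial_relation[OF w deg inv three])
  hence "fps_nth (fps_of_poly (R - smult ((- \<i>) ^ w) S - pcompose R [:-\<i>, 1:]) * inverse D) n = 0"
    by simp
  hence "fps_nth F n - (- \<i>) ^ w * A - B = 0"
    by (simp add: F_def A_def B_def fps_of_poly_diff fps_of_poly_smult left_diff_distrib mult.assoc)
  hence "poly Z (- of_nat n) + (- \<i>) ^ w * (- A) + - B = 0"
    by (simp add: F)
  thus "let T = (\<lambda>k :: nat. \<Sum>m = 0..k + n. \<Sum>j = 0..k + n - m.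
                 of_nat ((k + n) choose n) * of_nat ((m + w) choose w) *
                 of_nat ((w + 1) choose j) *
                 ((- 1) ^ (j + 1) * (- \<i>) ^ k / (1 - \<i>) ^ (m + w + 1)) *
                 poly Z (of_nat m + of_nat j - of_nat k - of_nat n))
       in summable T \<and>
          poly Z (- of_nat n)
            + (- \<i>) ^ w * (\<Sum>m = 1..n + 1. laurent_a w n (- int m) * poly Z (1 - of_nat m))
            + (\<Sum>k. T k) = 0"
    unfolding Let_def T_def[symmetric] A using sums by (simp add: sums_iff)
qed

end
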